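(* If $p$ is an integer with $p\ge 3$, then $\mathrm{ex}(p+4,B_p)=(p+2)(p+3)/2$.
   Context: The book $B_p$ is the graph consisting of $p$ triangles sharing a common edge. For a graph $H$ and positive integer $n$, $\mathrm{ex}(n,H)$ is the maximum number of edges of a simple graph of order $n$ not containing $H$ as a subgraph. *)

theory Defs
  imports Complex_Main
begin

type_synonym 'a graph = "'a set \<times> 'a set set"

abbreviation verts :: "'a graph \<Rightarrow> 'a set" where
  "verts G \<equiv> fst G"

abbreviation edges :: "'a graph \<Rightarrow> 'a set set" where
  "edges G \<equiv> snd G"

definition simple_graph :: "'a graph \<Rightarrow> bool" where
  "simple_graph G \<longleftrightarrow> finite (verts G) \<and> (\<forall>e \<in> edges G. e \<subseteq> verts G \<and> card e = 2)"

text \<open>Containment as a subgraph, up to isomorphism and not necessarily induced: there is an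
  injective map of the vertices of \<open>H\<close> into those of \<open>G\<close> taking edges to edges.\<close>

definition contains_subgraph :: "'a graph \<Rightarrow> 'b graph \<Rightarrow> bool" where
  "contains_subgraph G H \<longleftrightarrow>
     (\<exists>f. inj_on f (verts H) \<and> f ` verts H \<subseteq> verts G \<and> (\<forall>e \<in> edges H. f ` e \<in> edges G))"

text \<open>Every finite simple graph is isomorphic to one with vertices in \<open>nat\<close>, so it suffices
  to let the host graphs range over these. The set of edge counts is finite, being bounded by
  \<open>n choose 2\<close>; it is nonempty, so that \<open>Max\<close> is meaningful, whenever \<open>H\<close> has an edge.\<close>

definition ex :: "nat \<Rightarrow> 'b graph \<Rightarrow> nat" where
  "ex n H = Max {card (edges G) | G :: nat graph.
     simple_graph G \<and> card (verts G) = n \<and> \<not> contains_subgraph G H}"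

text \<open>The common edge is \<open>{0, 1}\<close>; the apexes of the \<open>p\<close> triangles are \<open>2, \<dots>, p + 1\<close>.\<close>

definition book :: "nat \<Rightarrow> nat graph" where
  "book p = ({..<p + 2}, {{0, 1}} \<union> (\<Union>i \<in> {2..<p + 2}. {{0, i}, {1, i}}))"

end

theory Submission imports Defs
begin

text \<open>Work in the complement of a graph on \<open>n = p + 4\<close> vertices. There are \<open>p + 2\<close> vertices outside
  an edge \<open>uv\<close>, so the graph has no \<open>B\<^sub>p\<close> iff any two vertices that are non-adjacent in the complement
  have at least three complement neighbours between them. If the complement has an isolated vertex,
  all other vertices have complement degree at least 3; otherwise any two vertices of complement
  degree 1 are joined in the complement, so there are at most two of them. Either way the complement
  degrees sum to at least \<open>2n - 2\<close>, and equality holds when the complement is the disjoint union of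
  a single edge and a cycle of length \<open>p + 2 \<ge> 5\<close>.\<close>

section \<open>Neighbourhoods in a graph and in its complement\<close>

definition neighbours :: "'a graph \<Rightarrow> 'a \<Rightarrow> 'a set" where
  "neighbours G u = {x \<in> verts G. {u, x} \<in> edges G}"

text \<open>This is the neighbourhood of \<open>u\<close> in the complement graph.\<close>

definition non_neighbours :: "'a graph \<Rightarrow> 'a \<Rightarrow> 'a set" where
  "non_neighbours G u = {x \<in> verts G. x \<noteq> u \<and> {u, x} \<notin> edges G}"

lemma finite_verts: "simple_graph G \<Longrightarrow> finite (verts G)"
  by (simp add: simple_graph_def)

lemma edge_endpoints:
  assumes "simple_graph G" "{u, v} \<in> edges G"
  shows "u \<noteq> v" "u \<in> verts G" "v \<in> verts G"
  using assms by (auto simp: simple_graph_def)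

lemma finite_neighbours: "simple_graph G \<Longrightarrow> finite (neighbours G u)"
  by (simp add: neighbours_def finite_verts)

lemma finite_non_neighbours: "simple_graph G \<Longrightarrow> finite (non_neighbours G u)"
  by (simp add: non_neighbours_def finite_verts)

lemma finite_edges: "simple_graph G \<Longrightarrow> finite (edges G)"
  by (rule finite_subset[of _ "Pow (verts G)"]) (auto simp: simple_graph_def)

text \<open>Handshake by double counting: \<open>x \<mapsto> {u, x}\<close> matches the neighbours
  of \<open>u\<close> with the edges through \<open>u\<close>, and each edge contains exactly two
  vertices.\<close>

lemma sum_card_neighbours:
  assumes G: "simple_graph G"
  shows "(\<Sum>u\<in>verts G. card (neighbours G u)) = 2 * card (edges G)"
proof -
  have "card (neighbours G u) = card {e \<in> edges G. u \<in> e}" if "u \<in> verts G" for u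
  proof (rule bij_betw_same_card[of "\<lambda>x. {u, x}"], unfold bij_betw_def, intro conjI)
    show "inj_on (\<lambda>x. {u, x}) (neighbours G u)"
      by (auto simp: inj_on_def doubleton_eq_iff)
    show "(\<lambda>x. {u, x}) ` neighbours G u = {e \<in> edges G. u \<in> e}"
    proof (intro equalityI subsetI)
      fix e assume e: "e \<in> {e \<in> edges G. u \<in> e}"
      then have "card e = 2" using G by (auto simp: simple_graph_def)
      then obtain a b where "e = {a, b}" by (auto simp: card_2_iff)
      then obtain x where "e = {u, x}" using e by auto
      then show "e \<in> (\<lambda>x. {u, x}) ` neighbours G u"
        using e edge_endpoints(3)[OF G] by (auto simp: neighbours_def)
    qed (auto simp: neighbours_def)
  qed
  then have "(\<Sum>u\<in>verts G. card (neighbours G u)) = (\<Sum>u\<in>verts G. card {e \<in> edges G. u \<in> e})"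
    by simp
  also have "\<dots> = 2 * card (edges G)"
  proof (rule sum_multicount[OF finite_verts[OF G] finite_edges[OF G]], intro ballI)
    fix e assume "e \<in> edges G"
    then have "{u \<in> verts G. u \<in> e} = e" "card e = 2" using G by (auto simp: simple_graph_def)
    then show "card {u \<in> verts G. u \<in> e} = 2" by simp
  qed
  finally show ?thesis .
qed

lemma card_neighbours_non_neighbours:
  assumes G: "simple_graph G" and u: "u \<in> verts G"
  shows "card (neighbours G u) + card (non_neighbours G u) = card (verts G) - 1"
proof -
  have "neighbours G u \<union> non_neighbours G u = verts G - {u}"
    using edge_endpoints[OF G] by (auto simp: neighbours_def non_neighbours_def)
  moreover have "neighbours G u \<inter> non_neighbours G u = {}"
    by (auto simp: neighbours_def non_neighbours_def)
  ultimately show ?thesis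
    using card_Un_disjoint[OF finite_neighbours[OF G] finite_non_neighbours[OF G], of u u] u
      finite_verts[OF G]
    by simp
qed

section \<open>Books as edges with many common neighbours\<close>

text \<open>The apexes of a copy are distinct common neighbours of the ends of its common edge.
  Conversely, any \<open>p\<close> common neighbours serve as apexes; they differ from
  \<open>u\<close> and \<open>v\<close> since there are no loops.\<close>

lemma contains_book_iff:
  assumes G: "simple_graph G"
  shows "contains_subgraph G (book p) \<longleftrightarrow>
    (\<exists>u v. {u, v} \<in> edges G \<and> p \<le> card (neighbours G u \<inter> neighbours G v))"
proof
  assume "contains_subgraph G (book p)"
  then obtain f where inj: "inj_on f {..<p + 2}" and im: "f ` {..<p + 2} \<subseteq> verts G"
    and e01: "f ` {0, 1} \<in> edges G"
    and ei: "\<And>i. i \<in> {2..<p + 2} \<Longrightarrow> f ` {0, i} \<in> edges G \<and> f ` {1, i} \<in> edges G"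
    by (auto simp: contains_subgraph_def book_def)
  have "f ` {2..<p + 2} \<subseteq> neighbours G (f 0) \<inter> neighbours G (f 1)"
    using ei im by (auto simp: neighbours_def)
  then have "card (f ` {2..<p + 2}) \<le> card (neighbours G (f 0) \<inter> neighbours G (f 1))"
    by (intro card_mono) (simp_all add: finite_neighbours[OF G])
  moreover have "card (f ` {2..<p + 2}) = p"
    by (subst card_image) (auto intro: inj_on_subset[OF inj])
  moreover have "{f 0, f 1} \<in> edges G" using e01 by simp
  ultimately show "\<exists>u v. {u, v} \<in> edges G \<and> p \<le> card (neighbours G u \<inter> neighbours G v)"
    by auto
next
  assume "\<exists>u v. {u, v} \<in> edges G \<and> p \<le> card (neighbours G u \<inter> neighbours G v)"
  then obtain u v where uv: "{u, v} \<in> edges G"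
    and le: "p \<le> card (neighbours G u \<inter> neighbours G v)" by auto
  obtain T where T: "T \<subseteq> neighbours G u \<inter> neighbours G v" "card T = p" "finite T"
    using obtain_subset_with_card_n[OF le] by metis
  obtain g where g: "bij_betw g {2..<p + 2} T"
    using finite_same_card_bij[of "{2..<p + 2}" T] T by auto
  define f where "f i = (if i = 0 then u else if i = 1 then v else g i)" for i :: nat
  have gT: "g i \<in> neighbours G u" "g i \<in> neighbours G v" if "2 \<le> i" "i < p + 2" for i
    using g T(1) that by (auto simp: bij_betw_def)
  have guv: "g i \<noteq> u" "g i \<noteq> v" if "2 \<le> i" "i < p + 2" for i
    using gT[OF that] edge_endpoints(1)[OF G] by (auto simp: neighbours_def)
  have ginj: "i = j" if "g i = g j" "2 \<le> i" "i < p + 2" "2 \<le> j" "j < p + 2" for i j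
    using g that by (auto simp: bij_betw_def inj_on_def)
  have cases: "i = 0 \<or> i = 1 \<or> 2 \<le> i" for i :: nat by auto
  have "inj_on f {..<p + 2}"
  proof (rule inj_onI)
    fix i j assume ij: "i \<in> {..<p + 2}" "j \<in> {..<p + 2}" "f i = f j"
    then show "i = j"
      using cases[of i] cases[of j] edge_endpoints(1)[OF G uv] guv[of i] guv[of j] ginj[of i j]
      by (auto simp: f_def split: if_splits)
  qed
  moreover have "f ` {..<p + 2} \<subseteq> verts G"
  proof (rule image_subsetI)
    fix i assume "i \<in> {..<p + 2}"
    then show "f i \<in> verts G"
      using cases[of i] edge_endpoints[OF G uv] gT(1)[of i] by (auto simp: f_def neighbours_def)
  qed
  moreover have "\<forall>e \<in> edges (book p). f ` e \<in> edges G"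
    using uv gT by (auto simp: book_def f_def neighbours_def insert_commute)
  ultimately show "contains_subgraph G (book p)"
    by (auto simp: contains_subgraph_def book_def)
qed

text \<open>A vertex outside \<open>{u, v}\<close> either is a common neighbour or misses one of the
  two. As \<open>u\<close> and \<open>v\<close> are adjacent, neither is a non-neighbour of the
  other, so the three parts are disjoint.\<close>

lemma card_common_neighbours:
  assumes G: "simple_graph G" and uv: "{u, v} \<in> edges G"
  shows "card (neighbours G u \<inter> neighbours G v) + card (non_neighbours G u \<union> non_neighbours G v) + 2
    = card (verts G)"
proof -
  have vu: "{v, u} \<in> edges G" using uv by (simp add: insert_commute)
  have "verts G = (neighbours G u \<inter> neighbours G v) \<union>
      (non_neighbours G u \<union> non_neighbours G v) \<union> {u, v}"
    using edge_endpoints[OF G uv] by (auto simp: neighbours_def non_neighbours_def)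
  moreover have "(neighbours G u \<inter> neighbours G v) \<inter> (non_neighbours G u \<union> non_neighbours G v) = {}"
    by (auto simp: neighbours_def non_neighbours_def)
  moreover have "((neighbours G u \<inter> neighbours G v) \<union>
      (non_neighbours G u \<union> non_neighbours G v)) \<inter> {u, v} = {}"
    using uv vu edge_endpoints(1)[OF G, of u u] edge_endpoints(1)[OF G, of v v]
    by (auto simp: neighbours_def non_neighbours_def)
  moreover have "card {u, v} = 2" using edge_endpoints(1)[OF G uv] by simp
  ultimately show ?thesis
    by (metis G card_Un_disjoint finite.emptyI finite.insertI finite_Int finite_UnI
        finite_neighbours finite_non_neighbours)
qed

lemma contains_book_iff_non_neighbours:
  assumes G: "simple_graph G" and n: "card (verts G) = p + 4"
  shows "contains_subgraph G (book p) \<longleftrightarrow>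
    (\<exists>u v. {u, v} \<in> edges G \<and> card (non_neighbours G u \<union> non_neighbours G v) \<le> 2)"
proof -
  have "p \<le> card (neighbours G u \<inter> neighbours G v) \<longleftrightarrow>
      card (non_neighbours G u \<union> non_neighbours G v) \<le> 2" if "{u, v} \<in> edges G" for u v
    using card_common_neighbours[OF G that] n by linarith
  then show ?thesis using contains_book_iff[OF G] by metis
qed

section \<open>The upper bound\<close>

lemma sum_card_non_neighbours_ge:
  assumes G: "simple_graph G" and n: "card (verts G) = p + 4"
    and free: "\<not> contains_subgraph G (book p)"
  shows "2 * (p + 3) \<le> (\<Sum>u\<in>verts G. card (non_neighbours G u))"
proof -
  have three: "3 \<le> card (non_neighbours G u \<union> non_neighbours G v)" if "{u, v} \<in> edges G" for u v
    using free that contains_book_iff_non_neighbours[OF G n] by fastforce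
  show ?thesis
  proof (cases "\<exists>w\<in>verts G. non_neighbours G w = {}")
    case True
    then obtain w where w: "w \<in> verts G" "non_neighbours G w = {}" by auto
    have "3 \<le> card (non_neighbours G v)" if "v \<in> verts G - {w}" for v
    proof -
      have "{w, v} \<in> edges G" using w that by (auto simp: non_neighbours_def)
      from three[OF this] show ?thesis using w by simp
    qed
    then have "(\<Sum>v\<in>verts G - {w}. 3) \<le> (\<Sum>v\<in>verts G - {w}. card (non_neighbours G v))"
      by (rule sum_mono)
    \<comment> \<open>The \<open>p + 3\<close> vertices other than \<open>w\<close> contribute at
      least \<open>3 * (p + 3)\<close>.\<close>
    then show ?thesis
      using w n finite_verts[OF G] by (simp add: sum.remove[of "verts G" w])
  next
    case False
    define L where "L = {u \<in> verts G. card (non_neighbours G u) = 1}"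
    have "card L \<le> 2"
    proof (cases "L = {}")
      case False
      then obtain u where u: "u \<in> L" by auto
      \<comment> \<open>Two members of \<open>L\<close> that are adjacent in \<open>G\<close> would
        have at most two non-neighbours in all, against \<open>three\<close>. So \<open>L\<close>
        lies in the closed complement neighbourhood of \<open>u\<close>, which has two
        elements.\<close>
      have "v \<in> insert u (non_neighbours G u)" if "v \<in> L" for v
      proof (rule ccontr)
        assume "v \<notin> insert u (non_neighbours G u)"
        then have "{u, v} \<in> edges G" using that by (auto simp: L_def non_neighbours_def)
        from three[OF this] card_Un_le[of "non_neighbours G u" "non_neighbours G v"]
        show False using that u by (auto simp: L_def)
      qed
      then have "card L \<le> card (insert u (non_neighbours G u))"
        by (intro card_mono) (auto simp: finite_non_neighbours[OF G])
      also have "\<dots> \<le> Suc (card (non_neighbours G u))" by (rule card_insert_le_m1) simp_all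
      also have "\<dots> = 2" using u by (simp add: L_def)
      finally show ?thesis .
    qed simp
    have "2 * card (verts G) = (\<Sum>u\<in>verts G. 2)" by simp
    \<comment> \<open>Complement degrees are positive here, so raising those equal to 1 by one makes
      all of them at least 2, at a total cost of \<open>card L\<close>.\<close>
    also have "\<dots> \<le> (\<Sum>u\<in>verts G. card (non_neighbours G u) +
        (if card (non_neighbours G u) = 1 then 1 else 0))"
    proof (rule sum_mono)
      fix u assume "u \<in> verts G"
      then have "card (non_neighbours G u) \<noteq> 0"
        using False finite_non_neighbours[OF G] by auto
      then show "2 \<le> card (non_neighbours G u) +
        (if card (non_neighbours G u) = 1 then 1 else 0)" by auto
    qed
    also have "\<dots> = (\<Sum>u\<in>verts G. card (non_neighbours G u)) + card L"
      using finite_verts[OF G] by (simp add: sum.distrib L_def sum.If_cases Int_def)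
    finally have "2 * (p + 4) \<le> (\<Sum>u\<in>verts G. card (non_neighbours G u)) + card L"
      unfolding n .
    then show ?thesis using \<open>card L \<le> 2\<close> by simp
  qed
qed

text \<open>Degrees in the graph and in its complement sum to \<open>(p + 4) * (p + 3)\<close>, of
  which the complement takes at least \<open>2 * (p + 3)\<close>.\<close>

lemma card_edges_book_free_le:
  assumes G: "simple_graph G" and n: "card (verts G) = p + 4"
    and free: "\<not> contains_subgraph G (book p)"
  shows "2 * card (edges G) \<le> (p + 2) * (p + 3)"
proof -
  have "2 * card (edges G) + (\<Sum>u\<in>verts G. card (non_neighbours G u)) =
      (\<Sum>u\<in>verts G. card (neighbours G u) + card (non_neighbours G u))"
    by (simp add: sum.distrib sum_card_neighbours[OF G])
  also have "\<dots> = (p + 4) * (p + 3)"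
    using card_neighbours_non_neighbours[OF G] n by simp
  finally show ?thesis
    using sum_card_non_neighbours_ge[OF assms] by (simp add: algebra_simps)
qed

section \<open>The extremal construction\<close>

text \<open>The cycle \<open>0, 1, \<dots>, p + 1\<close> together with the edge joining \<open>p + 2\<close> and \<open>p + 3\<close>.\<close>

definition cycle_and_edge :: "nat \<Rightarrow> nat set set" where
  "cycle_and_edge p = insert {0, p + 1} ((\<lambda>i. {i, Suc i}) ` insert (p + 2) {..p})"

definition extremal_graph :: "nat \<Rightarrow> nat graph" where
  "extremal_graph p = ({..<p + 4}, {e. e \<subseteq> {..<p + 4} \<and> card e = 2} - cycle_and_edge p)"

lemma simple_extremal_graph: "simple_graph (extremal_graph p)"
  by (auto simp: simple_graph_def extremal_graph_def)

lemma card_verts_extremal_graph: "card (verts (extremal_graph p)) = p + 4"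
  by (simp add: extremal_graph_def)

text \<open>The index set has \<open>p + 2\<close> elements, and the closing edge adds one. For
  \<open>p = 0\<close> that edge would coincide with \<open>{0, 1}\<close>.\<close>

lemma card_cycle_and_edge:
  assumes "p \<ge> 1"
  shows "card (cycle_and_edge p) = p + 3"
proof -
  have "inj_on (\<lambda>i::nat. {i, Suc i}) A" for A
    by (auto simp: inj_on_def doubleton_eq_iff)
  moreover have "{0, p + 1} \<notin> (\<lambda>i. {i, Suc i}) ` insert (p + 2) {..p}"
    using assms by (auto simp: doubleton_eq_iff)
  ultimately show ?thesis
    by (simp add: cycle_and_edge_def card_image del: image_insert)
qed

lemma card_edges_extremal_graph:
  assumes "p \<ge> 1"
  shows "2 * card (edges (extremal_graph p)) = (p + 2) * (p + 3)"
proof -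
  have "cycle_and_edge p \<subseteq> {e. e \<subseteq> {..<p + 4} \<and> card e = 2}"
    by (auto simp: cycle_and_edge_def)
  moreover have "finite (cycle_and_edge p)"
    by (simp add: cycle_and_edge_def)
  ultimately have "card (edges (extremal_graph p)) = ((p + 4) choose 2) - (p + 3)"
    using n_subsets[of "{..<p + 4}" 2]
    by (simp add: extremal_graph_def card_Diff_subset card_cycle_and_edge[OF assms])
  moreover have "2 * ((p + 4) choose 2) = (p + 4) * (p + 3)"
    by (simp add: choose_two)
  ultimately show ?thesis by (simp add: algebra_simps)
qed

text \<open>This turns adjacency in the complement into arithmetic, so that the case analysis below
  can be automated.\<close>

lemma doubleton_in_cycle_and_edge_iff:
  "{a, b} \<in> cycle_and_edge p \<longleftrightarrow>
    (a = 0 \<and> b = p + 1) \<or> (b = 0 \<and> a = p + 1) \<or>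
    (b = Suc a \<and> (a \<le> p \<or> a = p + 2)) \<or> (a = Suc b \<and> (b \<le> p \<or> b = p + 2))"
  by (auto simp: cycle_and_edge_def doubleton_eq_iff image_iff)

lemma non_neighbours_extremal_graph:
  assumes "u < p + 4"
  shows "non_neighbours (extremal_graph p) u = {x. x < p + 4 \<and> {u, x} \<in> cycle_and_edge p}"
  using assms
  by (auto simp: non_neighbours_def extremal_graph_def doubleton_in_cycle_and_edge_iff)

text \<open>A cycle vertex has two complement neighbours, and the single edge supplies a third if
  \<open>v\<close> lies on it. Otherwise both lie on a cycle of length at least 5, where
  non-adjacent vertices share at most one neighbour.\<close>

lemma card_non_neighbours_extremal_graph:
  assumes p: "p \<ge> 3" and uv: "u < v" "v < p + 4" "{u, v} \<notin> cycle_and_edge p"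
  shows "3 \<le> card (non_neighbours (extremal_graph p) u \<union> non_neighbours (extremal_graph p) v)"
proof -
  define N where "N = non_neighbours (extremal_graph p) u \<union> non_neighbours (extremal_graph p) v"
  have N: "x \<in> N \<longleftrightarrow> x < p + 4 \<and> ({u, x} \<in> cycle_and_edge p \<or> {v, x} \<in> cycle_and_edge p)" for x
    using uv by (auto simp: N_def non_neighbours_extremal_graph)
  note adj = doubleton_in_cycle_and_edge_iff
  have "\<exists>x y z. {x, y, z} \<subseteq> N \<and> x \<noteq> y \<and> y \<noteq> z \<and> x \<noteq> z"
  proof (cases "v \<ge> p + 2")
    case True
    then have "v = p + 2 \<or> v = p + 3" using uv by auto
    \<comment> \<open>The other end of the single edge, hence the complement neighbour of
      \<open>v\<close>.\<close>
    then obtain w where w: "v = p + 2 \<and> w = p + 3 \<or> v = p + 3 \<and> w = p + 2" by blast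
    consider "u = 0" | "u = p + 1" | "0 < u" "u \<le> p"
      using True uv by (force simp: adj)
    then show ?thesis
    proof cases
      case 1
      then have "{1, p + 1, w} \<subseteq> N" "w > p + 1" using w uv p by (auto simp: N adj)
      then show ?thesis using p by (intro exI[of _ 1] exI[of _ "p + 1"] exI[of _ w]) auto
    next
      case 2
      then have "{0, p, w} \<subseteq> N" "w > p" using w uv p by (auto simp: N adj)
      then show ?thesis using p by (intro exI[of _ 0] exI[of _ p] exI[of _ w]) auto
    next
      case 3
      then have "{u - 1, u + 1, w} \<subseteq> N" "w > u + 1" using w uv p by (auto simp: N adj)
      then show ?thesis by (intro exI[of _ "u - 1"] exI[of _ "u + 1"] exI[of _ w]) auto
    qed
  next
    case False
    \<comment> \<open>The witnesses are both cycle neighbours of \<open>u\<close> and one neighbour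
      of \<open>v\<close> that \<open>u\<close> does not share. The cases track where the cycle
      wraps around.\<close>
    consider "u = 0" "v < p" | "u = 0" "v = p" | "u = 1" "v = p + 1" | "2 \<le> u" "v = p + 1"
      | "1 \<le> u" "v \<le> p"
      using False uv by (force simp: adj)
    then show ?thesis
    proof cases
      case 1
      then have "{1, p + 1, v + 1} \<subseteq> N" using uv by (auto simp: N adj)
      then show ?thesis using 1 uv p
        by (intro exI[of _ 1] exI[of _ "p + 1"] exI[of _ "v + 1"]) auto
    next
      case 2
      \<comment> \<open>\<open>p + 1\<close> is shared by \<open>0\<close> and \<open>p\<close>, so
        the third witness is \<open>p - 1\<close>; it differs from \<open>1\<close> because
        \<open>p \<ge> 3\<close>. The next case likewise needs \<open>p \<noteq> 2\<close>.\<close>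
      then have "{1, p + 1, p - 1} \<subseteq> N" using p by (auto simp: N adj)
      then show ?thesis using p
        by (intro exI[of _ 1] exI[of _ "p + 1"] exI[of _ "p - 1"]) auto
    next
      case 3
      then have "{0, 2, p} \<subseteq> N" using p by (auto simp: N adj)
      then show ?thesis using p by (intro exI[of _ 0] exI[of _ 2] exI[of _ p]) auto
    next
      case 4
      then have "{u - 1, u + 1, 0} \<subseteq> N" using uv by (auto simp: N adj)
      then show ?thesis using 4
        by (intro exI[of _ "u - 1"] exI[of _ "u + 1"] exI[of _ 0]) auto
    next
      case 5
      then have "{u - 1, u + 1, v + 1} \<subseteq> N" using uv by (auto simp: N adj)
      then show ?thesis using 5 uv
        by (intro exI[of _ "u - 1"] exI[of _ "u + 1"] exI[of _ "v + 1"]) auto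
    qed
  qed
  then obtain x y z where xyz: "{x, y, z} \<subseteq> N" "x \<noteq> y" "y \<noteq> z" "x \<noteq> z" by blast
  then have "card {x, y, z} \<le> card N"
    by (intro card_mono) (simp_all add: N_def finite_non_neighbours simple_extremal_graph)
  then show ?thesis using xyz by (simp add: N_def)
qed

lemma extremal_graph_book_free:
  assumes "p \<ge> 3"
  shows "\<not> contains_subgraph (extremal_graph p) (book p)"
proof
  assume "contains_subgraph (extremal_graph p) (book p)"
  then obtain u v where uv: "{u, v} \<in> edges (extremal_graph p)"
    and le: "card (non_neighbours (extremal_graph p) u \<union> non_neighbours (extremal_graph p) v) \<le> 2"
    using contains_book_iff_non_neighbours[OF simple_extremal_graph card_verts_extremal_graph]
    by blast
  \<comment> \<open>Both orders are recorded because the preceding lemma assumes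
    \<open>u < v\<close>.\<close>
  have "u \<noteq> v" "u < p + 4" "v < p + 4" "{u, v} \<notin> cycle_and_edge p" "{v, u} \<notin> cycle_and_edge p"
    using edge_endpoints[OF simple_extremal_graph uv] uv
    by (auto simp: extremal_graph_def insert_commute)
  then have "3 \<le> card (non_neighbours (extremal_graph p) u \<union> non_neighbours (extremal_graph p) v)"
    using card_non_neighbours_extremal_graph[OF assms, of u v]
      card_non_neighbours_extremal_graph[OF assms, of v u]
    by (cases u v rule: linorder_cases) (auto simp: Un_commute)
  with le show False by simp
qed

theorem theorem6:
  fixes p :: nat
  assumes "p \<ge> 3"
  shows "real (ex (p + 4) (book p)) = real ((p + 2) * (p + 3)) / 2"
proof -
  let ?S = "{card (edges G) | G :: nat graph.
     simple_graph G \<and> card (verts G) = p + 4 \<and> \<not> contains_subgraph G (book p)}"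
  have edges: "2 * card (edges (extremal_graph p)) = (p + 2) * (p + 3)"
    using card_edges_extremal_graph assms by simp
  have upper: "m \<le> card (edges (extremal_graph p))" if "m \<in> ?S" for m
    using that card_edges_book_free_le edges by fastforce
  \<comment> \<open>\<open>upper\<close> gives finiteness as well as maximality.\<close>
  have "finite ?S"
    by (rule finite_subset[of _ "{..card (edges (extremal_graph p))}"]) (use upper in auto)
  moreover have "card (edges (extremal_graph p)) \<in> ?S"
    using simple_extremal_graph card_verts_extremal_graph extremal_graph_book_free[OF assms]
    by blast
  ultimately have "ex (p + 4) (book p) = card (edges (extremal_graph p))"
    unfolding ex_def using upper by (intro Max_eqI)
  then have "2 * ex (p + 4) (book p) = (p + 2) * (p + 3)" using edges by simp
  then have "2 * real (ex (p + 4) (book p)) = real ((p + 2) * (p + 3))"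
    by (metis of_nat_mult of_nat_numeral)
  then show ?thesis by simp
qed

end
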